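(* Let $w$ be an infinite word over a finite alphabet, and let $C>2$ and $0<\alpha<1$ be two constants. If for each $n$ each factor of $w$ of length $n$ contains a factor of exponent at least $C$ and of length of period at least $\alpha n$, then $w$ is infinite closed-rich.
   Context: Infinite words are one-sided sequences over a finite alphabet. A factor of a word is a contiguous finite subword. A period of a finite word $v=v_0\cdots v_{m-1}$ is an integer $t\ge 1$ with $v_{i+t}=v_i$ for all $0\le i<m-t$; "the period" of a word always means its shortest period $t$, and the exponent of a non-empty finite word $v$ is $|v|/t$ for this shortest period $t$. A border of a finite word $v$ is a proper prefix of $v$ which is also a suffix of $v$. A finite word $v$ is closed if $|v|\le 1$, or if $|v|\ge 2$ and the longest border of $v$ is non-empty and occurs in $v$ exactly twice (as a prefix and as a suffix). An infinite word $w$ is (infinite) closed-rich if there exists a constant $c>0$ such that for each $n\in\mathbb{N}$ each factor of $w$ of length $n$ contains at least $cn^2$ distinct closed factors. *)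

theory Defs
  imports Complex_Main "HOL-Library.Sublist"
begin

text \<open>
  Finite words are lists, infinite words are functions on the natural numbers, and
  factors of a finite word are given by \<^const>\<open>sublist\<close> (contiguous sublists).
\<close>

definition factor_of :: "'a list \<Rightarrow> (nat \<Rightarrow> 'a) \<Rightarrow> bool" where
  "factor_of v w \<longleftrightarrow> (\<exists>i. v = map w [i..<i + length v])"

definition is_period :: "nat \<Rightarrow> 'a list \<Rightarrow> bool" where
  "is_period t v \<longleftrightarrow> t \<ge> 1 \<and> (\<forall>i. i + t < length v \<longrightarrow> v ! (i + t) = v ! i)"

definition period :: "'a list \<Rightarrow> nat" where
  "period v = (LEAST t. is_period t v)"

text \<open>
  Only meaningful for non-empty words. The exponent never exceeds the length, so a word of
  length at most 2 has no factor of exponent greater than 2: a hypothesis that each factor of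
  length \<open>n\<close> contains such a factor can only be asked for all sufficiently large \<open>n\<close>.
\<close>

definition exponent :: "'a list \<Rightarrow> real" where
  "exponent v = real (length v) / real (period v)"

definition border :: "'a list \<Rightarrow> 'a list \<Rightarrow> bool" where
  "border b v \<longleftrightarrow> strict_prefix b v \<and> suffix b v"

definition longest_border :: "'a list \<Rightarrow> 'a list \<Rightarrow> bool" where
  "longest_border b v \<longleftrightarrow> border b v \<and> (\<forall>b'. border b' v \<longrightarrow> length b' \<le> length b)"

text \<open>Starting positions; occurrences may overlap.\<close>

definition occurrences :: "'a list \<Rightarrow> 'a list \<Rightarrow> nat set" where
  "occurrences b v = {i. i + length b \<le> length v \<and> take (length b) (drop i v) = b}"

text \<open>
  A border of a word is shorter than the word, so its occurrences as a prefix and as a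
  suffix are distinct; having exactly two occurrences means there is no further one.
\<close>

definition closed_word :: "'a list \<Rightarrow> bool" where
  "closed_word v \<longleftrightarrow> length v \<le> 1 \<or>
     (\<exists>b. longest_border b v \<and> b \<noteq> [] \<and> card (occurrences b v) = 2)"

definition infinite_closed_rich :: "(nat \<Rightarrow> 'a) \<Rightarrow> bool" where
  "infinite_closed_rich w \<longleftrightarrow>
     (\<exists>c::real. c > 0 \<and>
        (\<forall>n u. factor_of u w \<and> length u = n \<longrightarrow>
           real (card {v. sublist v u \<and> closed_word v}) \<ge> c * (real n)\<^sup>2))"

end

theory Submission
  imports Defs
begin

text \<open>
  Let \<open>v\<close> be a factor of exponent at least \<open>C > 2\<close> and of shortest period \<open>p\<close>. By
  minimality of \<open>p\<close>, a factor of \<open>v\<close> of length at least \<open>p\<close> cannot recur at a distance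
  smaller than \<open>p\<close>. Hence every factor of \<open>v\<close> of length at least \<open>2p\<close> is closed: its border of
  colength \<open>p\<close> has length at least \<open>p\<close> and therefore no occurrence in between. For the same
  reason factors of length at least \<open>p\<close> starting at different positions below \<open>p\<close> are
  distinct. Counting lengths between \<open>2p\<close> and \<open>Cp\<close> gives quadratically many closed factors in \<open>p\<close>, hence in \<open>n\<close>.
\<close>

lemma is_period_period:
  assumes "v \<noteq> []"
  shows "is_period (period v) v"
  unfolding period_def
proof (rule LeastI)
  show "is_period (length v) v"
    using assms by (cases v) (auto simp: is_period_def)
qed

lemma period_le: "is_period t v \<Longrightarrow> period v \<le> t"
  unfolding period_def by (rule Least_le)

lemma nth_mod_period:
  assumes "is_period p v" and "x < length v"
  shows "v ! x = v ! (x mod p)"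
  using assms(2)
proof (induction x rule: less_induct)
  case (less x)
  show ?case
  proof (cases "x < p")
    case False
    have "p \<ge> 1" using assms(1) by (simp add: is_period_def)
    have "v ! x = v ! (x - p)"
      using assms(1) less.prems False
      by (metis is_period_def le_add_diff_inverse2 linorder_not_less)
    also have "\<dots> = v ! ((x - p) mod p)"
      using less \<open>p \<ge> 1\<close> False by (intro less.IH) auto
    also have "(x - p) mod p = x mod p"
      using False by (simp add: le_mod_geq)
    finally show ?thesis .
  qed simp
qed

text \<open>A window of \<open>p\<close> consecutive positions meets every residue class modulo
  \<open>p\<close>, so agreement of two such windows spreads to all of \<open>v\<close>. The shift
  \<open>j - i\<close> would then be a period below the shortest one.\<close>

lemma no_close_recurrence:
  assumes "v \<noteq> []" and "p = period v"
    and "i < j" and "j < i + p" and "j + p \<le> length v"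
    and eq: "\<And>s. s < p \<Longrightarrow> v ! (i + s) = v ! (j + s)"
  shows False
proof -
  have per: "is_period p v" using is_period_period assms(1,2) by simp
  define k where "k = j - i"
  have k: "j = i + k" "1 \<le> k" "k < p" using assms(3,4) by (auto simp: k_def)
  have "is_period k v"
    unfolding is_period_def
  proof (intro conjI allI impI)
    fix x assume x: "x + k < length v"
    \<comment> \<open>Move \<open>x\<close> by a multiple of \<open>p\<close> into the window of length \<open>p\<close> starting at \<open>i\<close>.\<close>
    define s where "s = (x + i * (p - 1)) mod p"
    have s: "s < p" using k by (simp add: s_def)
    have "(i + s) mod p = (i + (x + i * (p - 1))) mod p"
      by (simp add: s_def mod_simps)
    \<comment> \<open>The summand \<open>i * (p - 1)\<close> acts as -i modulo \<open>p\<close>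
      while avoiding truncated subtraction.\<close>
    also have "i + (x + i * (p - 1)) = x + i * p"
      using k by (cases p) auto
    finally have m: "(i + s) mod p = x mod p" by simp
    have m': "(j + s) mod p = (x + k) mod p"
      using m k(1) by (metis add.assoc add.commute mod_add_left_eq)
    have "v ! (x + k) = v ! (j + s)"
      using nth_mod_period[OF per x] nth_mod_period[OF per, of "j + s"] m' s assms(5) by simp
    also have "\<dots> = v ! (i + s)" using eq s by simp
    also have "\<dots> = v ! x"
      using nth_mod_period[OF per, of x] nth_mod_period[OF per, of "i + s"] m s x assms(3,5)
      by simp
    finally show "v ! (x + k) = v ! x" .
  qed (use k in auto)
  from period_le[OF this] k assms(2) show False by simp
qed

text \<open>Spares a separate search for the longest border: the occurrence set of a single prefix
  already decides maximality.\<close>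

lemma closed_wordI:
  assumes "0 < m" and "m < length x"
    and occ: "occurrences (take m x) x = {0, length x - m}"
  shows "closed_word x"
proof -
  let ?b = "take m x"
  have "length x - m \<in> occurrences ?b x" using occ by simp
  then have "drop (length x - m) x = ?b"
    using assms by (auto simp: occurrences_def)
  then have border: "border ?b x"
    using assms unfolding border_def
    by (metis length_take less_not_refl min.absorb4 strict_prefixI suffix_drop take_is_prefix)
  \<comment> \<open>A longer border would have \<open>?b\<close> as a prefix and so place an occurrence strictly in between.\<close>
  have "length b' \<le> length ?b" if b': "border b' x" for b'
  proof (rule ccontr)
    assume "\<not> length b' \<le> length ?b"
    then have len: "m < length b'" using assms by simp
    have "strict_prefix b' x" "suffix b' x" using b' by (auto simp: border_def)
    then have lt: "length b' < length x" and pre: "take (length b') x = b'"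
      by (auto simp: prefix_length_less) (auto simp: strict_prefix_def prefix_def)
    from \<open>suffix b' x\<close> obtain z where "x = z @ b'" by (auto simp: suffix_def)
    then have suf: "drop (length x - length b') x = b'" by simp
    have "take m (drop (length x - length b') x) = take m b'" using suf by simp
    also have "\<dots> = ?b" using pre len by (metis min.absorb3 take_take)
    finally have "length x - length b' \<in> occurrences ?b x"
      using assms(1,2) len lt by (simp add: occurrences_def)
    then show False using occ len lt by auto
  qed
  then have "longest_border ?b x" using border by (simp add: longest_border_def)
  moreover have "card (occurrences ?b x) = 2" using occ assms by simp
  ultimately show ?thesis
    unfolding closed_word_def using assms by (intro disjI2 exI[of _ ?b]) auto
qed

lemma closed_word_long_factor:
  assumes "v \<noteq> []" and "p = period v" and "2 * p \<le> l" and "i + l \<le> length v"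
  shows "closed_word (take l (drop i v))"
proof -
  let ?x = "take l (drop i v)" and ?m = "l - p"
  have per: "is_period p v" using is_period_period assms(1,2) by simp
  then have p: "p \<ge> 1" by (simp add: is_period_def)
  have len: "length ?x = l" using assms by simp
  have occ: "k \<in> occurrences (take ?m ?x) ?x \<longleftrightarrow>
      k \<le> p \<and> (\<forall>s < ?m. v ! (i + (k + s)) = v ! (i + s))" for k
  proof -
    have "take ?m (drop k ?x) = take ?m ?x \<longleftrightarrow> (\<forall>s < ?m. v ! (i + (k + s)) = v ! (i + s))"
      if "k \<le> p"
      using that len assms by (subst list_eq_iff_nth_eq) (auto simp: add.assoc)
    moreover have "k + length (take ?m ?x) \<le> length ?x \<longleftrightarrow> k \<le> p"
      using len assms by auto
    moreover have "length (take ?m ?x) = ?m" using len by simp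
    ultimately show ?thesis unfolding occurrences_def by auto
  qed
  have "occurrences (take ?m ?x) ?x = {0, p}"
  proof (intro set_eqI iffI)
    fix k assume "k \<in> occurrences (take ?m ?x) ?x"
    then have k: "k \<le> p" "\<And>s. s < ?m \<Longrightarrow> v ! (i + (k + s)) = v ! (i + s)"
      using occ by auto
    \<comment> \<open>Since \<open>2 * p \<le> l\<close>, the agreement covers
      \<open>?m \<ge> p\<close> letters, a full period, and it would recur at the distance
      \<open>k < p\<close>.\<close>
    have False if "k \<noteq> 0" "k \<noteq> p"
      using that k assms
      by (intro no_close_recurrence[of v p i "i + k"]) (auto simp: add.assoc)
    then show "k \<in> {0, p}" by auto
  next
    fix k assume "k \<in> {0, p}"
    moreover have "v ! (i + (p + s)) = v ! (i + s)" if "s < ?m" for s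
    proof -
      have "i + s + p < length v" using that assms by simp
      then have "v ! (i + s + p) = v ! (i + s)" using per by (simp add: is_period_def)
      then show ?thesis by (simp add: ac_simps)
    qed
    ultimately show "k \<in> occurrences (take ?m ?x) ?x" using occ by auto
  qed
  then show ?thesis
    using len p assms by (intro closed_wordI[of ?m]) auto
qed

text \<open>Two starts below \<open>p\<close> differ by less than \<open>p\<close>, so equality of
  the first \<open>p\<close> letters alone already forbids distinct starts, whichever comes
  first.\<close>

lemma long_factors_eqD:
  assumes "v \<noteq> []" and "p = period v"
    and "i < p" and "j < p" and "p \<le> l"
    and "i + l \<le> length v" and "j + l \<le> length v"
    and eq: "take l (drop i v) = take l (drop j v)"
  shows "i = j"
proof -
  have nth: "v ! (i + s) = v ! (j + s)" if "s < p" for s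
  proof -
    have "take l (drop i v) ! s = take l (drop j v) ! s" by (simp only: eq)
    then show ?thesis using that assms(5-7) by simp
  qed
  show ?thesis
    using no_close_recurrence[of v p i j] no_close_recurrence[of v p j i] nth assms
    by (metis add.commute add_le_cancel_left le_trans less_nat_zero_code linorder_neqE_nat
        trans_less_add2)
qed

lemma finite_sublists: "finite {v. sublist v u}"
proof -
  have "{v. sublist v u} = set (sublists u)" by auto
  then show ?thesis by simp
qed

text \<open>There are \<open>K\<close> starts and \<open>K\<close> lengths from \<open>2 * p\<close>
  on. The last factor ends at \<open>(K - 1) + 2 * p + (K - 1)\<close>, whence the
  \<open>+ 2\<close>; \<open>K \<le> p\<close> keeps all starts below \<open>p\<close>.\<close>

lemma square_le_card_closed_factors:
  assumes "v \<noteq> []" and "p = period v" and "K \<le> p" and "2 * p + 2 * K \<le> length v + 2"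
  shows "K\<^sup>2 \<le> card {x. sublist x v \<and> closed_word x}"
proof -
  define f where "f = (\<lambda>(i, j). take (2 * p + j) (drop i v))"
  have fits: "i + (2 * p + j) \<le> length v" if "i < K" "j < K" for i j
    using that assms by simp
  have "inj_on f ({..<K} \<times> {..<K})"
  proof (rule inj_onI, clarsimp simp: f_def)
    fix i j i' j'
    assume lt: "i < K" "j < K" "i' < K" "j' < K"
      and eq: "take (2 * p + j) (drop i v) = take (2 * p + j') (drop i' v)"
    \<comment> \<open>No factor is truncated by the end of \<open>v\<close>, so its length reveals
      \<open>j\<close>; only then are the starts compared.\<close>
    have "j = j'" using arg_cong[OF eq, of length] fits[of i j] fits[of i' j'] lt by auto
    moreover have "i = i'"
      using eq lt assms(3) fits[of i j] fits[of i' j'] \<open>j = j'\<close>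
      by (intro long_factors_eqD[OF assms(1,2), of _ _ "2 * p + j"]) auto
    ultimately show "i = i' \<and> j = j'" by simp
  qed
  moreover have "f ` ({..<K} \<times> {..<K}) \<subseteq> {x. sublist x v \<and> closed_word x}"
    using fits assms(1,2)
    by (auto simp: f_def intro!: closed_word_long_factor
        intro: sublist_order.order_trans[OF sublist_take sublist_drop])
  ultimately have "card ({..<K} \<times> {..<K}) \<le> card {x. sublist x v \<and> closed_word x}"
    by (intro card_inj_on_le) (auto intro: finite_subset[OF _ finite_sublists])
  then show ?thesis by (simp add: power2_eq_square)
qed

lemma card_closed_factors_ge:
  fixes \<delta> :: real
  assumes "v \<noteq> []" and "0 < \<delta>" and "\<delta> \<le> 1" and "exponent v \<ge> 2 + \<delta>"
  shows "(\<delta> / 2 * real (period v))\<^sup>2 \<le> real (card {x. sublist x v \<and> closed_word x})"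
proof -
  define p where "p = period v"
  have p: "p \<ge> 1" using is_period_period[OF assms(1)] by (simp add: is_period_def p_def)
  \<comment> \<open>The excess length \<open>\<delta> * p\<close> is split evenly between starts and
    lengths. The side of the square will be \<open>Suc q\<close>, so rounding down costs
    nothing.\<close>
  define q where "q = nat \<lfloor>\<delta> / 2 * real p\<rfloor>"
  have q: "real q \<le> \<delta> / 2 * real p" "\<delta> / 2 * real p \<le> real (Suc q)"
  proof -
    have "0 \<le> \<delta> / 2 * real p" using assms by simp
    then have "real q = of_int \<lfloor>\<delta> / 2 * real p\<rfloor>" unfolding q_def by simp
    then show "real q \<le> \<delta> / 2 * real p" "\<delta> / 2 * real p \<le> real (Suc q)" by linarith+
  qed
  have "(2 + \<delta>) * real p \<le> real (length v)"
    using assms(4) p by (simp add: exponent_def p_def field_simps)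
  then have "real (2 * p + 2 * q) \<le> real (length v)" using q(1) by (simp add: algebra_simps)
  then have "2 * p + 2 * q \<le> length v" by (simp only: of_nat_le_iff)
  then have 1: "2 * p + 2 * Suc q \<le> length v + 2" by simp
  \<comment> \<open>Here the cap \<open>\<delta> \<le> 1\<close> keeps the starts within one
    period.\<close>
  have "\<delta> / 2 * real p < real p" using assms p by simp
  then have 2: "Suc q \<le> p" using q(1) by linarith
  have "(\<delta> / 2 * real p)\<^sup>2 \<le> (real (Suc q))\<^sup>2"
    using q(2) assms by (intro power_mono) auto
  also have "\<dots> = real ((Suc q)\<^sup>2)" by simp
  also have "\<dots> \<le> real (card {x. sublist x v \<and> closed_word x})"
    using square_le_card_closed_factors[OF assms(1) p_def 2 1] by (rule of_nat_mono)
  finally show ?thesis by (simp add: p_def)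
qed

theorem proposition7:
  fixes w :: "nat \<Rightarrow> 'a" and A :: "'a set" and C \<alpha> :: real
  assumes "finite A" and "range w \<subseteq> A"
    and "C > 2" and "0 < \<alpha>" and "\<alpha> < 1"
    and "\<exists>N. \<forall>n\<ge>N. \<forall>u. factor_of u w \<and> length u = n \<longrightarrow>
           (\<exists>v. sublist v u \<and> v \<noteq> [] \<and> exponent v \<ge> C \<and> real (period v) \<ge> \<alpha> * real n)"
  shows "infinite_closed_rich w"
proof -
  obtain N where N: "\<And>u. length u \<ge> N \<Longrightarrow> factor_of u w \<Longrightarrow>
      \<exists>v. sublist v u \<and> v \<noteq> [] \<and> exponent v \<ge> C \<and> real (period v) \<ge> \<alpha> * real (length u)"
    using assms(6) by blast
  \<comment> \<open>Large exponents are cut down to 3, which still leaves a positive excess over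
    2.\<close>
  define \<delta> where "\<delta> = min 1 (C - 2)"
  have \<delta>: "0 < \<delta>" "\<delta> \<le> 1" "2 + \<delta> \<le> C" using assms(3) by (auto simp: \<delta>_def)
  \<comment> \<open>The first bound serves words of length at least \<open>N\<close>. The second
    makes the required count at most 1 for shorter words, where the empty factor suffices;
    \<open>Suc N\<close> avoids division by zero.\<close>
  define c where "c = min ((\<delta> / 2 * \<alpha>)\<^sup>2) (1 / (real (Suc N))\<^sup>2)"
  have "c > 0" using \<delta> assms(4) by (simp add: c_def)
  moreover have "real (card {v. sublist v u \<and> closed_word v}) \<ge> c * (real (length u))\<^sup>2"
    if u: "factor_of u w" for u
  proof -
    let ?S = "{v. sublist v u \<and> closed_word v}"
    have fin: "finite ?S" by (rule finite_subset[OF _ finite_sublists]) auto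
    show ?thesis
    proof (cases "length u \<ge> N")
      case True
      then obtain v where v: "sublist v u" "v \<noteq> []" "exponent v \<ge> C"
        "real (period v) \<ge> \<alpha> * real (length u)"
        using N u by blast
      have "c * (real (length u))\<^sup>2 \<le> (\<delta> / 2 * \<alpha>)\<^sup>2 * (real (length u))\<^sup>2"
        by (intro mult_right_mono) (auto simp: c_def)
      also have "\<dots> = (\<delta> / 2 * (\<alpha> * real (length u)))\<^sup>2"
        by (simp add: power_mult_distrib power_divide)
      also have "\<dots> \<le> (\<delta> / 2 * real (period v))\<^sup>2"
        using v(4) \<delta> assms(4) by (intro power_mono mult_left_mono) auto
      also have "\<dots> \<le> real (card {x. sublist x v \<and> closed_word x})"
        using v \<delta> by (intro card_closed_factors_ge) auto
      also have "\<dots> \<le> real (card ?S)"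
        using v(1) fin by (intro of_nat_mono card_mono) (auto intro: sublist_order.order_trans)
      finally show ?thesis .
    next
      case False
      have "c * (real (length u))\<^sup>2 \<le> 1 / (real (Suc N))\<^sup>2 * (real (Suc N))\<^sup>2"
        using False by (intro mult_mono power_mono) (auto simp: c_def)
      also have "\<dots> = 1" by simp
      also have "1 \<le> real (card ?S)"
      proof -
        have "[] \<in> ?S" by (simp add: closed_word_def)
        then have "card ?S > 0" using fin by (auto simp: card_gt_0_iff)
        then show ?thesis by linarith
      qed
      finally show ?thesis .
    qed
  qed
  ultimately show ?thesis unfolding infinite_closed_rich_def by blast
qed

end
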